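(* Let $R$ be a commutative ring and $E$ a subset of $\operatorname{Spec}(R)$. Let $\pi: R\to\prod_{\mathfrak{p}\in E}R_{\mathfrak{p}}$ be the canonical ring map $r\mapsto (r/1)_{\mathfrak{p}\in E}$, and let $\pi^{\ast}:\operatorname{Spec}\big(\prod_{\mathfrak{p}\in E}R_{\mathfrak{p}}\big)\to\operatorname{Spec}(R)$ be the induced map. Then $\operatorname{Im}\pi^{\ast}\subseteq c\ell(E)$, where $c\ell(E)$ denotes the closure of $E$ in $\operatorname{Spec}(R)$ with respect to the flat topology.
   Context: All rings are commutative (with identity). A ring map $\phi:A\to B$ induces $\phi^{\ast}:\operatorname{Spec}(B)\to\operatorname{Spec}(A)$, $\phi^{\ast}(\mathfrak{q})=\phi^{-1}(\mathfrak{q})$. The flat (or inverse) topology on $\operatorname{Spec}(R)$ is the topology for which the sets $V(a)=\{\mathfrak{p}\in\operatorname{Spec}(R): a\in\mathfrak{p}\}$, $a\in R$, form a sub-basis of open sets; equivalently, the sets $V(I)$ with $I$ a finitely generated ideal of $R$ form a basis of open sets. $R_{\mathfrak{p}}$ is the localization of $R$ at the prime $\mathfrak{p}$. *)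

theory Defs
  imports "HOL-Algebra.QuotRing" "HOL-Analysis.Function_Topology"
begin

section \<open>Localization\<close>

definition frac_rel :: "('a, 'm) ring_scheme \<Rightarrow> 'a set \<Rightarrow> (('a \<times> 'a) \<times> ('a \<times> 'a)) set"
  where "frac_rel R S = {((a, s), (b, t)). a \<in> carrier R \<and> s \<in> S \<and> b \<in> carrier R \<and> t \<in> S \<and>
    (\<exists>u\<in>S. u \<otimes>\<^bsub>R\<^esub> (t \<otimes>\<^bsub>R\<^esub> a) = u \<otimes>\<^bsub>R\<^esub> (s \<otimes>\<^bsub>R\<^esub> b))}"

definition fraction :: "('a, 'm) ring_scheme \<Rightarrow> 'a set \<Rightarrow> 'a \<Rightarrow> 'a \<Rightarrow> ('a \<times> 'a) set"
  where "fraction R S a s = frac_rel R S `` {(a, s)}"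

text \<open>The sum and product of two classes are unions over all choices of representatives; all the
  classes in such a union coincide (lemmas \<open>mult_frac\<close> and \<open>add_frac\<close> below).\<close>

definition localization :: "('a, 'm) ring_scheme \<Rightarrow> 'a set \<Rightarrow> ('a \<times> 'a) set ring"
  where "localization R S =
    \<lparr>carrier = (carrier R \<times> S) // frac_rel R S,
     mult = (\<lambda>X Y. \<Union>(a, s)\<in>X. \<Union>(b, t)\<in>Y. fraction R S (a \<otimes>\<^bsub>R\<^esub> b) (s \<otimes>\<^bsub>R\<^esub> t)),
     one = fraction R S \<one>\<^bsub>R\<^esub> \<one>\<^bsub>R\<^esub>,
     zero = fraction R S \<zero>\<^bsub>R\<^esub> \<one>\<^bsub>R\<^esub>,
     add = (\<lambda>X Y. \<Union>(a, s)\<in>X. \<Union>(b, t)\<in>Y.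
       fraction R S ((a \<otimes>\<^bsub>R\<^esub> t) \<oplus>\<^bsub>R\<^esub> (b \<otimes>\<^bsub>R\<^esub> s)) (s \<otimes>\<^bsub>R\<^esub> t))\<rparr>"

definition localization_at :: "('a, 'm) ring_scheme \<Rightarrow> 'a set \<Rightarrow> ('a \<times> 'a) set ring"
  where "localization_at R P = localization R (carrier R - P)"

section \<open>Products of rings\<close>

definition product_ring :: "'i set \<Rightarrow> ('i \<Rightarrow> ('b, 'm) ring_scheme) \<Rightarrow> ('i \<Rightarrow> 'b) ring"
  where "product_ring I A =
    \<lparr>carrier = (\<Pi>\<^sub>E i\<in>I. carrier (A i)),
     mult = (\<lambda>x y. \<lambda>i\<in>I. x i \<otimes>\<^bsub>A i\<^esub> y i),
     one = (\<lambda>i\<in>I. \<one>\<^bsub>A i\<^esub>),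
     zero = (\<lambda>i\<in>I. \<zero>\<^bsub>A i\<^esub>),
     add = (\<lambda>x y. \<lambda>i\<in>I. x i \<oplus>\<^bsub>A i\<^esub> y i)\<rparr>"

definition canonical_map :: "('a, 'm) ring_scheme \<Rightarrow> 'a set set \<Rightarrow> 'a \<Rightarrow> 'a set \<Rightarrow> ('a \<times> 'a) set"
  where "canonical_map R E r = (\<lambda>P\<in>E. fraction R (carrier R - P) r \<one>\<^bsub>R\<^esub>)"

section \<open>The prime spectrum and the flat topology\<close>

definition Spec :: "('a, 'm) ring_scheme \<Rightarrow> 'a set set"
  where "Spec R = {P. primeideal P R}"

definition spec_map :: "('a, 'm) ring_scheme \<Rightarrow> ('a \<Rightarrow> 'b) \<Rightarrow> 'b set \<Rightarrow> 'a set"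
  where "spec_map R \<phi> Q = {r \<in> carrier R. \<phi> r \<in> Q}"

definition vanishing_set :: "('a, 'm) ring_scheme \<Rightarrow> 'a \<Rightarrow> 'a set set"
  where "vanishing_set R a = {P \<in> Spec R. a \<in> P}"

definition flat_topology :: "('a, 'm) ring_scheme \<Rightarrow> 'a set topology"
  where "flat_topology R = topology_generated_by (vanishing_set R ` carrier R)"

section \<open>Well-definedness\<close>

locale localization_setup = cring R + submonoid S R for R (structure) and S
begin

lemma S_carrier: "s \<in> S \<Longrightarrow> s \<in> carrier R"
  using subset by blast

lemma equiv_frac_rel: "equiv (carrier R \<times> S) (frac_rel R S)"
proof (rule equivI)
  show "frac_rel R S \<subseteq> (carrier R \<times> S) \<times> (carrier R \<times> S)"
    by (auto simp: frac_rel_def)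
  show "refl_on (carrier R \<times> S) (frac_rel R S)"
    by (auto simp: frac_rel_def refl_on_def intro: one_closed)
  show "sym (frac_rel R S)"
    by (auto simp: frac_rel_def sym_def) (metis)
  show "trans (frac_rel R S)"
  proof (rule transI)
    fix x y z assume "(x, y) \<in> frac_rel R S" "(y, z) \<in> frac_rel R S"
    then obtain a s b t c w u v where
      xyz: "x = (a, s)" "y = (b, t)" "z = (c, w)"
      and R: "a \<in> carrier R" "b \<in> carrier R" "c \<in> carrier R"
      and S: "s \<in> S" "t \<in> S" "w \<in> S" "u \<in> S" "v \<in> S"
      and 1: "u \<otimes> (t \<otimes> a) = u \<otimes> (s \<otimes> b)" and 2: "v \<otimes> (w \<otimes> b) = v \<otimes> (t \<otimes> c)"
      by (auto simp: frac_rel_def)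
    note C = R S[THEN S_carrier]
    have "u \<otimes> v \<otimes> t \<otimes> (w \<otimes> a) = v \<otimes> w \<otimes> (u \<otimes> (t \<otimes> a))"
      using C by (simp add: m_ac)
    also have "\<dots> = u \<otimes> s \<otimes> (v \<otimes> (w \<otimes> b))"
      unfolding 1 using C by (simp add: m_ac)
    also have "\<dots> = u \<otimes> v \<otimes> t \<otimes> (s \<otimes> c)"
      unfolding 2 using C by (simp add: m_ac)
    finally show "(x, z) \<in> frac_rel R S"
      using xyz R S by (auto simp: frac_rel_def intro!: bexI[of _ "u \<otimes> v \<otimes> t"])
  qed
qed

lemma frac_eq_iff:
  assumes "a \<in> carrier R" "s \<in> S" "b \<in> carrier R" "t \<in> S"
  shows "fraction R S a s = fraction R S b t \<longleftrightarrow> (\<exists>u\<in>S. u \<otimes> (t \<otimes> a) = u \<otimes> (s \<otimes> b))"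
  unfolding fraction_def
  using eq_equiv_class_iff[OF equiv_frac_rel, of "(a, s)" "(b, t)"] assms
  by (auto simp: frac_rel_def)

lemma frac_closed:
  "a \<in> carrier R \<Longrightarrow> s \<in> S \<Longrightarrow> fraction R S a s \<in> carrier (localization R S)"
  by (auto simp: localization_def fraction_def intro: quotientI)

lemma carrier_cases:
  assumes "X \<in> carrier (localization R S)"
  obtains a s where "a \<in> carrier R" "s \<in> S" "X = fraction R S a s"
  using assms by (auto simp: localization_def fraction_def elim!: quotientE)

lemma mult_frac:
  assumes "a \<in> carrier R" "s \<in> S" "b \<in> carrier R" "t \<in> S"
  shows "fraction R S a s \<otimes>\<^bsub>localization R S\<^esub> fraction R S b t = fraction R S (a \<otimes> b) (s \<otimes> t)"
proof -
  have "(\<lambda>p q. fraction R S (fst p \<otimes> fst q) (snd p \<otimes> snd q)) respects2 frac_rel R S"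
  proof (rule congruent2_commuteI[OF equiv_frac_rel])
    show "fraction R S (fst p \<otimes> fst q) (snd p \<otimes> snd q) = fraction R S (fst q \<otimes> fst p) (snd q \<otimes> snd p)"
      if "p \<in> carrier R \<times> S" "q \<in> carrier R \<times> S" for p q
      using that by (auto simp: m_comm S_carrier)
    fix p q r assume p: "p \<in> carrier R \<times> S" and qr: "(q, r) \<in> frac_rel R S"
    obtain a s where p': "p = (a, s)" "a \<in> carrier R" "s \<in> S" using p by auto
    obtain b t c w u where q: "q = (b, t)" "r = (c, w)" "b \<in> carrier R" "c \<in> carrier R"
      "t \<in> S" "w \<in> S" "u \<in> S" and 1: "u \<otimes> (w \<otimes> b) = u \<otimes> (t \<otimes> c)"
      using qr by (auto simp: frac_rel_def)
    note C = p'(2) p'(3)[THEN S_carrier] q(3,4) q(5-7)[THEN S_carrier]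
    have "u \<otimes> (s \<otimes> w \<otimes> (a \<otimes> b)) = s \<otimes> a \<otimes> (u \<otimes> (w \<otimes> b))"
      using C by (simp add: m_ac)
    also have "\<dots> = u \<otimes> (s \<otimes> t \<otimes> (a \<otimes> c))"
      unfolding 1 using C by (simp add: m_ac)
    finally show "fraction R S (fst p \<otimes> fst q) (snd p \<otimes> snd q) =
        fraction R S (fst p \<otimes> fst r) (snd p \<otimes> snd r)"
      using p' q by (auto simp: frac_eq_iff)
  qed
  from UN_equiv_class2[OF equiv_frac_rel equiv_frac_rel this, of "(a, s)" "(b, t)"] assms
  show ?thesis
    by (simp add: localization_def fraction_def case_prod_unfold)
qed

lemma add_frac:
  assumes "a \<in> carrier R" "s \<in> S" "b \<in> carrier R" "t \<in> S"
  shows "fraction R S a s \<oplus>\<^bsub>localization R S\<^esub> fraction R S b t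
    = fraction R S ((a \<otimes> t) \<oplus> (b \<otimes> s)) (s \<otimes> t)"
proof -
  have "(\<lambda>p q. fraction R S ((fst p \<otimes> snd q) \<oplus> (fst q \<otimes> snd p)) (snd p \<otimes> snd q))
      respects2 frac_rel R S"
  proof (rule congruent2_commuteI[OF equiv_frac_rel])
    show "fraction R S ((fst p \<otimes> snd q) \<oplus> (fst q \<otimes> snd p)) (snd p \<otimes> snd q) =
        fraction R S ((fst q \<otimes> snd p) \<oplus> (fst p \<otimes> snd q)) (snd q \<otimes> snd p)"
      if "p \<in> carrier R \<times> S" "q \<in> carrier R \<times> S" for p q
      using that by (auto simp: m_comm a_comm S_carrier)
    fix p q r assume p: "p \<in> carrier R \<times> S" and qr: "(q, r) \<in> frac_rel R S"
    obtain a s where p': "p = (a, s)" "a \<in> carrier R" "s \<in> S" using p by auto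
    obtain b t c w u where q: "q = (b, t)" "r = (c, w)" "b \<in> carrier R" "c \<in> carrier R"
      "t \<in> S" "w \<in> S" "u \<in> S" and 1: "u \<otimes> (w \<otimes> b) = u \<otimes> (t \<otimes> c)"
      using qr by (auto simp: frac_rel_def)
    note C = p'(2) p'(3)[THEN S_carrier] q(3,4) q(5-7)[THEN S_carrier]
    have "u \<otimes> (s \<otimes> w \<otimes> ((a \<otimes> t) \<oplus> (b \<otimes> s)))
        = (u \<otimes> s \<otimes> w \<otimes> a \<otimes> t) \<oplus> (s \<otimes> s \<otimes> (u \<otimes> (w \<otimes> b)))"
      using C by (simp add: m_ac r_distr)
    also have "\<dots> = u \<otimes> (s \<otimes> t \<otimes> ((a \<otimes> w) \<oplus> (c \<otimes> s)))"
      unfolding 1 using C by (simp add: m_ac r_distr)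
    finally show "fraction R S ((fst p \<otimes> snd q) \<oplus> (fst q \<otimes> snd p)) (snd p \<otimes> snd q) =
        fraction R S ((fst p \<otimes> snd r) \<oplus> (fst r \<otimes> snd p)) (snd p \<otimes> snd r)"
      using p' q by (auto simp: frac_eq_iff S_carrier)
  qed
  from UN_equiv_class2[OF equiv_frac_rel equiv_frac_rel this, of "(a, s)" "(b, t)"] assms
  show ?thesis
    by (simp add: localization_def fraction_def case_prod_unfold)
qed

lemma one_localization: "\<one>\<^bsub>localization R S\<^esub> = fraction R S \<one> \<one>"
  and zero_localization: "\<zero>\<^bsub>localization R S\<^esub> = fraction R S \<zero> \<one>"
  by (simp_all add: localization_def)

lemma frac_eqI:
  assumes "a \<in> carrier R" "s \<in> S" "b \<in> carrier R" "t \<in> S" "t \<otimes> a = s \<otimes> b"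
  shows "fraction R S a s = fraction R S b t"
  using assms by (auto simp: frac_eq_iff intro: bexI[OF _ one_closed])

theorem cring_localization: "cring (localization R S)"
proof (rule cringI)
  let ?L = "localization R S"
  note [simp] = S_carrier frac_closed mult_frac add_frac one_localization zero_localization
  show "abelian_group ?L"
  proof (rule abelian_groupI)
    fix X assume "X \<in> carrier ?L"
    then obtain a s where X: "a \<in> carrier R" "s \<in> S" "X = fraction R S a s" by (rule carrier_cases)
    show "\<zero>\<^bsub>?L\<^esub> \<oplus>\<^bsub>?L\<^esub> X = X"
      using X by simp
    have "fraction R S (\<ominus> a) s \<oplus>\<^bsub>?L\<^esub> X = \<zero>\<^bsub>?L\<^esub>"
      using X by (simp add: l_minus l_neg) (rule frac_eqI, auto)
    then show "\<exists>Y\<in>carrier ?L. Y \<oplus>\<^bsub>?L\<^esub> X = \<zero>\<^bsub>?L\<^esub>"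
      using X by (intro bexI[of _ "fraction R S (\<ominus> a) s"]) auto
    fix Y assume "Y \<in> carrier ?L"
    then obtain b t where Y: "b \<in> carrier R" "t \<in> S" "Y = fraction R S b t" by (rule carrier_cases)
    show "X \<oplus>\<^bsub>?L\<^esub> Y \<in> carrier ?L" using X Y by simp
    show "X \<oplus>\<^bsub>?L\<^esub> Y = Y \<oplus>\<^bsub>?L\<^esub> X" using X Y by (simp add: m_comm a_comm)
    fix Z assume "Z \<in> carrier ?L"
    then obtain c w where Z: "c \<in> carrier R" "w \<in> S" "Z = fraction R S c w" by (rule carrier_cases)
    show "X \<oplus>\<^bsub>?L\<^esub> Y \<oplus>\<^bsub>?L\<^esub> Z = X \<oplus>\<^bsub>?L\<^esub> (Y \<oplus>\<^bsub>?L\<^esub> Z)"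
      using X Y Z by (simp add: m_ac a_ac r_distr)
  qed simp
  show "comm_monoid ?L"
  proof (rule comm_monoidI)
    fix X assume "X \<in> carrier ?L"
    then obtain a s where X: "a \<in> carrier R" "s \<in> S" "X = fraction R S a s" by (rule carrier_cases)
    show "\<one>\<^bsub>?L\<^esub> \<otimes>\<^bsub>?L\<^esub> X = X" using X by simp
    fix Y assume "Y \<in> carrier ?L"
    then obtain b t where Y: "b \<in> carrier R" "t \<in> S" "Y = fraction R S b t" by (rule carrier_cases)
    show "X \<otimes>\<^bsub>?L\<^esub> Y \<in> carrier ?L" using X Y by simp
    show "X \<otimes>\<^bsub>?L\<^esub> Y = Y \<otimes>\<^bsub>?L\<^esub> X" using X Y by (simp add: m_comm)
    fix Z assume "Z \<in> carrier ?L"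
    then obtain c w where Z: "c \<in> carrier R" "w \<in> S" "Z = fraction R S c w" by (rule carrier_cases)
    show "X \<otimes>\<^bsub>?L\<^esub> Y \<otimes>\<^bsub>?L\<^esub> Z = X \<otimes>\<^bsub>?L\<^esub> (Y \<otimes>\<^bsub>?L\<^esub> Z)"
      using X Y Z by (simp add: m_ac)
  qed simp
  fix X Y Z assume "X \<in> carrier ?L" "Y \<in> carrier ?L" "Z \<in> carrier ?L"
  obtain a s where X: "a \<in> carrier R" "s \<in> S" "X = fraction R S a s"
    using \<open>X \<in> carrier ?L\<close> by (rule carrier_cases)
  obtain b t where Y: "b \<in> carrier R" "t \<in> S" "Y = fraction R S b t"
    using \<open>Y \<in> carrier ?L\<close> by (rule carrier_cases)
  obtain c w where Z: "c \<in> carrier R" "w \<in> S" "Z = fraction R S c w"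
    using \<open>Z \<in> carrier ?L\<close> by (rule carrier_cases)
  show "(X \<oplus>\<^bsub>?L\<^esub> Y) \<otimes>\<^bsub>?L\<^esub> Z = X \<otimes>\<^bsub>?L\<^esub> Z \<oplus>\<^bsub>?L\<^esub> Y \<otimes>\<^bsub>?L\<^esub> Z"
    using X Y Z by simp (rule frac_eqI, simp_all add: m_ac r_distr l_distr)
qed

theorem frac_one_hom: "(\<lambda>r. fraction R S r \<one>) \<in> ring_hom R (localization R S)"
  by (rule ring_hom_memI)
    (simp_all add: frac_closed mult_frac add_frac one_localization)

end

lemma (in cring) localization_setup_prime:
  assumes "P \<in> Spec R"
  shows "localization_setup R (carrier R - P)"
proof -
  interpret P: primeideal P R using assms by (simp add: Spec_def)
  have "\<one> \<notin> P" using P.I_notcarr P.one_imp_carrier by auto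
  then show ?thesis
    by unfold_locales (use P.I_prime in auto)
qed

lemma cring_product_ring:
  assumes "\<And>i. i \<in> I \<Longrightarrow> cring (A i)"
  shows "cring (product_ring I A)"
proof (rule cringI)
  have closed: "x i \<in> carrier (A i)" if "x \<in> (\<Pi>\<^sub>E i\<in>I. carrier (A i))" "i \<in> I" for x i
    using that by auto
  have ring: "ring (A i)" if "i \<in> I" for i
    using assms[OF that] by (rule cring.axioms)
  have ag: "abelian_group (A i)" if "i \<in> I" for i
    using ring[OF that] by (rule ring.is_abelian_group)
  have am: "abelian_monoid (A i)" if "i \<in> I" for i
    using ag[OF that] by (rule abelian_group.axioms)
  have cm: "comm_monoid (A i)" if "i \<in> I" for i
    using assms[OF that] by (rule cring.axioms)
  have m: "monoid (A i)" if "i \<in> I" for i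
    using cm[OF that] by (rule comm_monoid.axioms)
  let ?P = "product_ring I A"
  show "abelian_group ?P"
  proof (rule abelian_groupI)
    fix x assume x: "x \<in> carrier ?P"
    show "\<exists>y\<in>carrier ?P. y \<oplus>\<^bsub>?P\<^esub> x = \<zero>\<^bsub>?P\<^esub>"
      using x ag by (intro bexI[of _ "\<lambda>i\<in>I. \<ominus>\<^bsub>A i\<^esub> x i"])
        (auto simp: product_ring_def abelian_group.l_neg abelian_group.a_inv_closed closed
          intro!: restrict_ext)
    show "\<zero>\<^bsub>?P\<^esub> \<oplus>\<^bsub>?P\<^esub> x = x"
      using x am by (auto simp: product_ring_def fun_eq_iff abelian_monoid.l_zero PiE_iff
          extensional_def)
    fix y assume y: "y \<in> carrier ?P"
    show "x \<oplus>\<^bsub>?P\<^esub> y = y \<oplus>\<^bsub>?P\<^esub> x"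
      using x y am by (auto simp: product_ring_def closed abelian_monoid.a_comm
          intro!: restrict_ext)
  qed (auto simp: product_ring_def closed am abelian_monoid.a_closed abelian_monoid.zero_closed
      abelian_monoid.a_assoc intro!: restrict_ext)
  show "comm_monoid ?P"
  proof (rule comm_monoidI)
    fix x assume x: "x \<in> carrier ?P"
    show "\<one>\<^bsub>?P\<^esub> \<otimes>\<^bsub>?P\<^esub> x = x"
      using x m by (auto simp: product_ring_def fun_eq_iff monoid.l_one PiE_iff extensional_def)
    fix y assume y: "y \<in> carrier ?P"
    show "x \<otimes>\<^bsub>?P\<^esub> y = y \<otimes>\<^bsub>?P\<^esub> x"
      using x y cm by (auto simp: product_ring_def closed comm_monoid.m_comm
          intro!: restrict_ext)
  qed (auto simp: product_ring_def closed m monoid.m_closed monoid.one_closed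
      monoid.m_assoc intro!: restrict_ext)
  show "(x \<oplus>\<^bsub>?P\<^esub> y) \<otimes>\<^bsub>?P\<^esub> z = x \<otimes>\<^bsub>?P\<^esub> z \<oplus>\<^bsub>?P\<^esub> y \<otimes>\<^bsub>?P\<^esub> z"
    if "x \<in> carrier ?P" "y \<in> carrier ?P" "z \<in> carrier ?P" for x y z
    using that by (auto simp: product_ring_def closed ring ring.ring_simprules(13) intro!: restrict_ext)
qed

context cring
begin

theorem cring_product_localizations:
  assumes "E \<subseteq> Spec R"
  shows "cring (product_ring E (localization_at R))"
proof (rule cring_product_ring)
  fix P assume "P \<in> E"
  with assms interpret localization_setup R "carrier R - P"
    by (intro localization_setup_prime) auto
  show "cring (localization_at R P)"
    unfolding localization_at_def by (rule cring_localization)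
qed

theorem canonical_map_hom:
  assumes "E \<subseteq> Spec R"
  shows "canonical_map R E \<in> ring_hom R (product_ring E (localization_at R))"
proof -
  have hom: "(\<lambda>r. fraction R (carrier R - P) r \<one>) \<in> ring_hom R (localization_at R P)"
    if "P \<in> E" for P
  proof -
    interpret localization_setup R "carrier R - P"
      using assms that by (intro localization_setup_prime) auto
    show ?thesis
      unfolding localization_at_def by (rule frac_one_hom)
  qed
  note closed = ring_hom_closed[OF hom] and mult = ring_hom_mult[OF hom]
    and add = ring_hom_add[OF hom] and one = ring_hom_one[OF hom]
  show ?thesis
    by (rule ring_hom_memI)
      (simp_all add: product_ring_def canonical_map_def closed mult add one cong: restrict_cong)
qed

theorem topspace_flat_topology: "topspace (flat_topology R) = Spec R"
proof -
  have "vanishing_set R \<zero> = Spec R"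
    by (auto simp: vanishing_set_def Spec_def primeideal_def ideal_def
        intro: additive_subgroup.zero_closed)
  then show ?thesis
    unfolding flat_topology_def topology_generated_by_topspace
    by (auto simp: vanishing_set_def)
qed

end

theorem spec_map_Spec:
  assumes "cring A" "cring B" "\<phi> \<in> ring_hom A B" "Q \<in> Spec B"
  shows "spec_map A \<phi> Q \<in> Spec A"
proof -
  interpret ring_hom_ring A B \<phi>
    using assms by (intro ring_hom_ring.intro ring_hom_ring_axioms.intro cring.axioms(1))
  show ?thesis
    using primeideal_vimage[of Q] assms by (simp add: Spec_def spec_map_def)
qed

end

(* For a prime Q of the product, the subsets D of E whose indicator idempotent lies in Q form an
   ideal of sets. If q is the contraction of Q and T is a flat open neighbourhood of q, then E - T
   belongs to it: this need only be checked on the subbasis, where T = V(a) with a in q, and there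
   the image of a lies in Q and is invertible at every prime of E - T. As Q is proper, the indicator
   of E is not in Q, so E - T is not all of E. *)
theory Submission
  imports Defs
begin

text \<open>The idempotent of the product cut out by \<open>D\<close>. Restricting to
  \<open>I\<close> makes it an element of the extensional carrier, so only the part of
  \<open>D\<close> inside \<open>I\<close> matters.\<close>

definition product_indicator :: "'i set \<Rightarrow> ('i \<Rightarrow> ('b, 'm) ring_scheme) \<Rightarrow> 'i set \<Rightarrow> 'i \<Rightarrow> 'b"
  where "product_indicator I A D = (\<lambda>i\<in>I. if i \<in> D then \<one>\<^bsub>A i\<^esub> else \<zero>\<^bsub>A i\<^esub>)"

locale product_ring_ideal = ideal Q "product_ring I A"
  for Q and I :: "'i set" and A :: "'i \<Rightarrow> ('b, 'm) ring_scheme" +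
  assumes components: "\<And>i. i \<in> I \<Longrightarrow> cring (A i)"
begin

lemma component_ring: "i \<in> I \<Longrightarrow> ring (A i)"
  using components by (rule cring.axioms)

text \<open>Multiply \<open>x\<close> by the family that inverts it on \<open>D\<close> and vanishes
  elsewhere: the product is the indicator of \<open>D\<close>, and \<open>Q\<close> absorbs
  multiplication.\<close>

lemma indicator_mem_if_units:
  assumes x: "x \<in> Q"
    and unit: "\<And>i. i \<in> I \<Longrightarrow> i \<in> D \<Longrightarrow> y i \<in> carrier (A i) \<and> y i \<otimes>\<^bsub>A i\<^esub> x i = \<one>\<^bsub>A i\<^esub>"
  shows "product_indicator I A D \<in> Q"
proof -
  let ?z = "\<lambda>i\<in>I. if i \<in> D then y i else \<zero>\<^bsub>A i\<^esub>"
  have xc: "x i \<in> carrier (A i)" if "i \<in> I" for i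
    using a_Hcarr[OF x] that by (auto simp: product_ring_def)
  have "?z \<in> carrier (product_ring I A)"
    using unit by (auto simp: product_ring_def ring.ring_simprules(2) component_ring)
  then have "?z \<otimes>\<^bsub>product_ring I A\<^esub> x \<in> Q"
    using x by (rule I_l_closed[rotated])
  moreover have "?z \<otimes>\<^bsub>product_ring I A\<^esub> x = product_indicator I A D"
    using unit xc by (auto simp: product_ring_def product_indicator_def component_ring
        ring.ring_simprules(24) intro!: restrict_ext)
  ultimately show ?thesis by simp
qed

text \<open>On \<open>D'\<close> the indicator of \<open>D\<close> is already 1, so the constant
  family 1 inverts it there.\<close>

lemma indicator_mem_mono:
  assumes "product_indicator I A D \<in> Q" "D' \<subseteq> D"
  shows "product_indicator I A D' \<in> Q"
  using assms(1)
proof (rule indicator_mem_if_units[where y = "\<lambda>i. \<one>\<^bsub>A i\<^esub>"])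
  fix i assume "i \<in> I" "i \<in> D'"
  then show "\<one>\<^bsub>A i\<^esub> \<in> carrier (A i) \<and> \<one>\<^bsub>A i\<^esub> \<otimes>\<^bsub>A i\<^esub> product_indicator I A D i = \<one>\<^bsub>A i\<^esub>"
    using assms(2) component_ring
    by (auto simp: product_indicator_def ring.ring_simprules(6) ring.ring_simprules(12))
qed

lemma indicator_mem_Un:
  assumes D: "product_indicator I A D \<in> Q" and D': "product_indicator I A D' \<in> Q"
  shows "product_indicator I A (D \<union> D') \<in> Q"
proof -
  \<comment> \<open>Making the two sets disjoint keeps the sum of the indicators from taking the
    value 1 + 1 on the overlap.\<close>
  have "product_indicator I A (D' - D) \<in> Q"
    using D' by (rule indicator_mem_mono) auto
  with D have "product_indicator I A D \<oplus>\<^bsub>product_ring I A\<^esub> product_indicator I A (D' - D) \<in> Q"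
    by (rule additive_subgroup.a_closed[OF is_additive_subgroup])
  moreover have "product_indicator I A D \<oplus>\<^bsub>product_ring I A\<^esub> product_indicator I A (D' - D)
      = product_indicator I A (D \<union> D')"
    by (auto simp: product_ring_def product_indicator_def component_ring
        ring.ring_simprules intro!: restrict_ext)
  ultimately show ?thesis by simp
qed

lemma indicator_index_set: "product_indicator I A I = \<one>\<^bsub>product_ring I A\<^esub>"
  by (auto simp: product_indicator_def product_ring_def intro!: restrict_ext)

end

lemma (in localization_setup) frac_inverse:
  assumes "a \<in> S"
  shows "fraction R S \<one> a \<otimes>\<^bsub>localization R S\<^esub> fraction R S a \<one> = \<one>\<^bsub>localization R S\<^esub>"
  using assms S_carrier by (simp add: mult_frac one_localization) (rule frac_eqI, auto)

theorem theorem3p9: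
  fixes R :: "('a, 'm) ring_scheme" and E :: "'a set set"
  assumes "cring R"
    and "E \<subseteq> Spec R"
  shows "spec_map R (canonical_map R E) ` Spec (product_ring E (localization_at R))
    \<subseteq> flat_topology R closure_of E"
proof
  interpret cring R by fact
  let ?P = "product_ring E (localization_at R)"
  let ?ind = "product_indicator E (localization_at R)"
  have loc: "localization_setup R (carrier R - P)" if "P \<in> E" for P
    using assms(2) that by (intro localization_setup_prime) auto
  fix q assume "q \<in> spec_map R (canonical_map R E) ` Spec ?P"
  then obtain Q where Q: "Q \<in> Spec ?P" and q: "q = spec_map R (canonical_map R E) Q"
    by blast
  interpret Q: primeideal Q ?P using Q by (simp add: Spec_def)
  interpret Q: product_ring_ideal Q E "localization_at R"
  proof (intro product_ring_ideal.intro product_ring_ideal_axioms.intro Q.is_ideal)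
    show "cring (localization_at R P)" if "P \<in> E" for P
      using localization_setup.cring_localization[OF loc[OF that]]
      by (simp add: localization_at_def)
  qed
  \<comment> \<open>Membership in the closure includes membership in the topspace, which is
    \<open>Spec R\<close>.\<close>
  have q_Spec: "q \<in> Spec R"
    unfolding q using spec_map_Spec[OF assms(1) cring_product_localizations canonical_map_hom Q]
    using assms(2) by blast
  \<comment> \<open>Induction on how \<open>T\<close> is generated. Passing to complements turns an
    intersection of open sets into a union of index sets, and a union of open sets into a smaller
    index set.\<close>
  have mem: "?ind (E - T) \<in> Q"
    if "generate_topology_on (vanishing_set R ` carrier R) T" "q \<in> T" for T
    using that
  proof induction
    case Empty
    then show ?case by simp
  next
    case (Int T U)
    then show ?case
      using Q.indicator_mem_Un[of "E - T" "E - U"] by (simp add: Diff_Int)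
  next
    case (UN K)
    \<comment> \<open>Some member of \<open>K\<close> contains \<open>q\<close>, and the induction
      hypothesis applies to it.\<close>
    then obtain T where "T \<in> K" "?ind (E - T) \<in> Q" by blast
    then show ?case by (auto elim: Q.indicator_mem_mono)
  next
    case (Basis T)
    then obtain a where a: "a \<in> carrier R" "T = vanishing_set R a" by blast
    with Basis have "canonical_map R E a \<in> Q"
      by (simp add: vanishing_set_def q spec_map_def)
    then show ?case
    \<comment> \<open>A prime of \<open>E\<close> outside V(a) does not contain \<open>a\<close>, so
      1/a exists in its local ring and inverts the component of the image of
      \<open>a\<close>.\<close>
    proof (rule Q.indicator_mem_if_units[where y = "\<lambda>P. fraction R (carrier R - P) \<one>\<^bsub>R\<^esub> a"])
      fix P assume P: "P \<in> E" "P \<in> E - T"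
      then have aP: "a \<in> carrier R - P"
        using a assms(2) by (auto simp: vanishing_set_def)
      interpret P: localization_setup R "carrier R - P" by (rule loc) fact
      show "fraction R (carrier R - P) \<one>\<^bsub>R\<^esub> a \<in> carrier (localization_at R P) \<and>
          fraction R (carrier R - P) \<one>\<^bsub>R\<^esub> a \<otimes>\<^bsub>localization_at R P\<^esub> canonical_map R E a P
            = \<one>\<^bsub>localization_at R P\<^esub>"
        using P(1) aP P.frac_inverse[OF aP]
        by (simp add: canonical_map_def localization_at_def P.frac_closed)
    qed
  qed
  have "\<one>\<^bsub>?P\<^esub> \<notin> Q"
    using Q.I_notcarr Q.one_imp_carrier by auto
  then have ind_E: "?ind E \<notin> Q"
    by (simp add: Q.indicator_index_set)
  show "q \<in> flat_topology R closure_of E"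
    unfolding in_closure_of topspace_flat_topology
  proof (intro conjI allI impI q_Spec)
    fix T assume "q \<in> T \<and> openin (flat_topology R) T"
    then have "?ind (E - T) \<in> Q"
      using mem by (simp add: flat_topology_def openin_topology_generated_by_iff)
    \<comment> \<open>If \<open>T\<close> missed \<open>E\<close>, the identity of the product would
      lie in the proper ideal \<open>Q\<close>.\<close>
    with ind_E have "E - T \<noteq> E" by auto
    then show "\<exists>P. P \<in> E \<and> P \<in> T" by blast
  qed
qed

end
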